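(* Let $k\ge 1$ and $n\geq 2$ be integers, let $r\in\mathbb{C}$, and let $\mathbf{P}_n=\mathrm{Circ}_r(P_{k,0},P_{k,1},\ldots,P_{k,n-1})$. Then $$\|\mathbf{P}_n\|_F=\sqrt{n\,\mathcal{S}^{(2)}_{n-1}+(|r|^2-1)\,\mathcal{W}^{(2)}_{n-1}}$$ and $$\|\mathbf{P}_n\|_1=n\,\mathcal{S}^{(1)}_{n-1}+(|r|-1)\,\mathcal{W}^{(1)}_{n-1}.$$
   Context: For an integer $k\geq 1$, the generalized $k$-Pell-Tribonacci sequence $(P_{k,n})_{n\ge 0}$ is defined by $P_{k,0}=0$, $P_{k,1}=1$, $P_{k,2}=2k$ and $P_{k,n}=2kP_{k,n-1}+kP_{k,n-2}+P_{k,n-3}$ for $n\geq 3$. Set $\mathcal{S}^{(1)}_n=\sum_{i=0}^n P_{k,i}$, $\mathcal{W}^{(1)}_n=\sum_{i=0}^n iP_{k,i}$, $\mathcal{S}^{(2)}_n=\sum_{i=0}^n P_{k,i}^2$, $\mathcal{W}^{(2)}_n=\sum_{i=0}^n iP_{k,i}^2$. For $n\ge 2$, $r\in\mathbb{C}$ and $a_0,\dots,a_{n-1}\in\mathbb{C}$, the $r$-circulant matrix $\mathrm{Circ}_r(a_0,\dots,a_{n-1})$ is the $n\times n$ matrix whose $(i,j)$ entry ($1\le i,j\le n$) is $a_{j-i}$ if $j\ge i$ and $r\,a_{n+j-i}$ if $j<i$. For $A=[a_{i,j}]\in\mathbb{C}^{n\times n}$: $\|A\|_F=\big(\sum_{i,j}|a_{i,j}|^2\big)^{1/2}$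 is the Frobenius norm and $\|A\|_1=\sum_{i,j}|a_{i,j}|$ is the entrywise $\ell_1$-norm. *)

theory Defs
  imports Complex_Main "Jordan_Normal_Form.Matrix"
begin

fun pell_trib :: "nat \<Rightarrow> nat \<Rightarrow> nat" where
  "pell_trib k 0 = 0"
| "pell_trib k (Suc 0) = 1"
| "pell_trib k (Suc (Suc 0)) = 2 * k"
| "pell_trib k (Suc (Suc (Suc n))) =
     2 * k * pell_trib k (Suc (Suc n)) + k * pell_trib k (Suc n) + pell_trib k n"

definition S1 :: "nat \<Rightarrow> nat \<Rightarrow> nat" where
  "S1 k n = (\<Sum>i=0..n. pell_trib k i)"

definition W1 :: "nat \<Rightarrow> nat \<Rightarrow> nat" where
  "W1 k n = (\<Sum>i=0..n. i * pell_trib k i)"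

definition S2 :: "nat \<Rightarrow> nat \<Rightarrow> nat" where
  "S2 k n = (\<Sum>i=0..n. (pell_trib k i)\<^sup>2)"

definition W2 :: "nat \<Rightarrow> nat \<Rightarrow> nat" where
  "W2 k n = (\<Sum>i=0..n. i * (pell_trib k i)\<^sup>2)"

(* Matrices and vectors are indexed from 0. The entries depend only on j - i and on whether
   j >= i, so the formula is the same as for indices running from 1 to n. *)
definition r_circulant :: "complex \<Rightarrow> complex vec \<Rightarrow> complex mat" where
  "r_circulant r a = mat (dim_vec a) (dim_vec a)
     (\<lambda>(i, j). if i \<le> j then a $ (j - i) else r * a $ (dim_vec a + j - i))"

definition frobenius_norm :: "complex mat \<Rightarrow> real" where
  "frobenius_norm A = sqrt (\<Sum>i<dim_row A. \<Sum>j<dim_col A. (cmod (A $$ (i, j)))\<^sup>2)"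

(* The entrywise norm, not the operator norm induced by the vector 1-norm. *)
definition entrywise_l1_norm :: "complex mat \<Rightarrow> real" where
  "entrywise_l1_norm A = (\<Sum>i<dim_row A. \<Sum>j<dim_col A. cmod (A $$ (i, j)))"

end

(* Column j of row i carries the entry with index (j - i) mod n, so every row contains each a_m
   exactly once; a_m comes with the factor r in exactly m of the n rows. *)
theory Submission
  imports Defs
begin

text \<open>The modulus and its square are multiplicative, so both norms come down to adding up f(m)
  over all entries that carry a_m, with an extra weight c on the entries below the diagonal: c = |r|
  or c = |r|^2. Since a_m occurs n - m times plainly and m times with the factor, its total weight
  is (n - m) + c m = n + (c - 1) m. This splits into the plain sum and the index-weighted sum in
  \<open>sum_r_circulant\<close>.\<close>

text \<open>Substitution m = (j - i) mod n along row i, a bijection of the column indices; column j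
  lies left of the diagonal exactly when i + m wraps past n.\<close>

lemma sum_cyclic_shift:
  fixes f :: "nat \<Rightarrow> 'a::comm_semiring_1"
  assumes "i < n"
  shows "(\<Sum>j<n. if i \<le> j then f (j - i) else c * f (n + j - i)) =
         (\<Sum>m<n. if i + m < n then f m else c * f m)"
  by (rule sum.reindex_bij_witness
        [where i = "\<lambda>m. if i + m < n then i + m else i + m - n"
           and j = "\<lambda>j. if i \<le> j then j - i else n + j - i"])
    (use assms in \<open>auto split: if_splits\<close>)

lemma sum_rows_with_factor:
  fixes x c :: real
  assumes "m \<le> n"
  shows "(\<Sum>i<n. if i + m < n then x else c * x) = real n * x + (c - 1) * (real m * x)"
proof -
  \<comment> \<open>The wrapped copies of a_m sit in the last m rows.\<close>
  have sets: "{..<n} \<inter> {i. i + m < n} = {..<n - m}" "{..<n} \<inter> - {i. i + m < n} = {n - m..<n}"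
    by auto
  have "(\<Sum>i<n. if i + m < n then x else c * x) = real (n - m) * x + real m * (c * x)"
    using assms by (simp add: sum.If_cases sets)
  then show ?thesis
    using assms by (simp add: of_nat_diff algebra_simps)
qed

text \<open>Exchanging the sums counts by the entry index m instead of by rows. Keeping f and c
  arbitrary lets one count serve both norms.\<close>

lemma sum_r_circulant:
  fixes f :: "nat \<Rightarrow> real"
  shows "(\<Sum>i<n. \<Sum>j<n. if i \<le> j then f (j - i) else c * f (n + j - i)) =
         real n * (\<Sum>m<n. f m) + (c - 1) * (\<Sum>m<n. real m * f m)"
proof -
  have "(\<Sum>i<n. \<Sum>j<n. if i \<le> j then f (j - i) else c * f (n + j - i)) =
        (\<Sum>i<n. \<Sum>m<n. if i + m < n then f m else c * f m)"
    by (simp add: sum_cyclic_shift)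
  also have "\<dots> = (\<Sum>m<n. \<Sum>i<n. if i + m < n then f m else c * f m)"
    by (rule sum.swap)
  also have "\<dots> = (\<Sum>m<n. real n * f m + (c - 1) * (real m * f m))"
    by (intro sum.cong refl sum_rows_with_factor) simp
  finally show ?thesis
    by (simp add: sum.distrib sum_distrib_left)
qed

lemma frobenius_norm_r_circulant:
  "frobenius_norm (r_circulant r (vec n a)) =
     sqrt (real n * (\<Sum>m<n. (cmod (a m))\<^sup>2) +
       ((cmod r)\<^sup>2 - 1) * (\<Sum>m<n. real m * (cmod (a m))\<^sup>2))"
proof -
  have "(\<Sum>i<n. \<Sum>j<n. (cmod (r_circulant r (vec n a) $$ (i, j)))\<^sup>2) =
        (\<Sum>i<n. \<Sum>j<n. if i \<le> j then (cmod (a (j - i)))\<^sup>2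
           else (cmod r)\<^sup>2 * (cmod (a (n + j - i)))\<^sup>2)"
    \<comment> \<open>Both lookups stay inside \<open>vec n a\<close>: j - i < n as j < n, and n + j
      - i < n as j < i in the second branch.\<close>
    by (intro sum.cong refl) (auto simp: r_circulant_def norm_mult power_mult_distrib)
  also note sum_r_circulant[where f = "\<lambda>m. (cmod (a m))\<^sup>2"]
  finally show ?thesis
    by (simp add: frobenius_norm_def r_circulant_def)
qed

lemma entrywise_l1_norm_r_circulant:
  "entrywise_l1_norm (r_circulant r (vec n a)) =
     real n * (\<Sum>m<n. cmod (a m)) + (cmod r - 1) * (\<Sum>m<n. real m * cmod (a m))"
proof -
  have "(\<Sum>i<n. \<Sum>j<n. cmod (r_circulant r (vec n a) $$ (i, j))) =
        (\<Sum>i<n. \<Sum>j<n. if i \<le> j then cmod (a (j - i)) else cmod r * cmod (a (n + j - i)))"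
    by (intro sum.cong refl) (auto simp: r_circulant_def norm_mult)
  also note sum_r_circulant[where f = "\<lambda>m. cmod (a m)"]
  finally show ?thesis
    by (simp add: entrywise_l1_norm_def r_circulant_def)
qed

theorem theorem1:
  fixes k n :: nat and r :: complex and P :: "complex mat"
  assumes "k \<ge> 1" and "n \<ge> 2"
    and "P = r_circulant r (vec n (\<lambda>i. of_nat (pell_trib k i)))"
  shows "frobenius_norm P =
           sqrt (real n * real (S2 k (n - 1)) + ((cmod r)\<^sup>2 - 1) * real (W2 k (n - 1)))
       \<and> entrywise_l1_norm P =
           real n * real (S1 k (n - 1)) + (cmod r - 1) * real (W1 k (n - 1))"
proof -
  \<comment> \<open>The sums \<open>S1\<close> to \<open>W2\<close> include their upper limit. For n
    = 0 truncated subtraction would give {0} instead of the empty set.\<close>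
  have "{0..n - 1} = {..<n}"
    using assms(2) by auto
  then show ?thesis
    by (simp add: assms(3) frobenius_norm_r_circulant entrywise_l1_norm_r_circulant
        S1_def W1_def S2_def W2_def)
qed

end
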